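(* Let $f \in \mathbb{Z}[x]$ be non-constant, and let $\rho \in \mathbb{Q}$ be a root bound for $f$. Let $\Delta \in \mathbb{N}$ be a factor degree lower bound for $f$. If we have $n \in \mathbb{Z}$ with $|n| > 1+\rho$ such that $|f(n)| = s\,p$, where $s$ is a positive integer with $s < (|n|-\rho)^{\Delta}$ and $p$ is prime, then $f$ is irreducible.
   Context: A root bound for $f$ is a number $\rho \in \mathbb{Q}$ such that $|\alpha| \le \rho$ for every $\alpha \in \mathbb{C}$ with $f(\alpha)=0$. A factor degree lower bound for $f \in \mathbb{Z}[x]$ is a number $\Delta \in \mathbb{N}$ such that all factor degrees less than $\Delta$ have been excluded: whenever $f = gh$ with $g, h \in \mathbb{Z}[x]$ both non-constant, we have $\deg g \ge \Delta$ and $\deg h \ge \Delta$. In particular $\Delta = 1$ is always a factor degree lower bound. *)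

theory Defs
  imports Complex_Main "HOL-Computational_Algebra.Computational_Algebra"
begin

definition root_bound :: "int poly \<Rightarrow> rat \<Rightarrow> bool" where
  "root_bound f \<rho> \<longleftrightarrow>
     (\<forall>\<alpha>::complex. poly (map_poly of_int f) \<alpha> = 0 \<longrightarrow> cmod \<alpha> \<le> of_rat \<rho>)"

definition factor_degree_lower_bound :: "int poly \<Rightarrow> nat \<Rightarrow> bool" where
  "factor_degree_lower_bound f \<Delta> \<longleftrightarrow>
     (\<forall>g h. f = g * h \<and> degree g > 0 \<and> degree h > 0 \<longrightarrow> degree g \<ge> \<Delta> \<and> degree h \<ge> \<Delta>)"

end

theory Submission imports Defs begin

text \<open>
  Suppose \<open>f = g * h\<close> over the integers with both factors non-constant. The prime \<open>p\<close> divides one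
  of \<open>g n\<close>, \<open>h n\<close>, so the other value, say \<open>g n\<close>, has absolute value at most \<open>s\<close>. But
  \<open>\<bar>g n\<bar>\<close> is \<open>\<bar>lead_coeff g\<bar> \<ge> 1\<close> times the product of the distances from \<open>n\<close> to the roots of \<open>g\<close>,
  each at least \<open>\<bar>n\<bar> - \<rho> > 1\<close>, and there are at least \<open>\<Delta>\<close> of them, contradicting
  \<open>s < (\<bar>n\<bar> - \<rho>) ^ \<Delta>\<close>. Gauss's lemma carries the conclusion over to the rationals.
\<close>

lemma map_poly_of_int_mult:
  "map_poly of_int (p * q) =
     (map_poly of_int p * map_poly of_int q :: 'a :: {comm_ring_1, ring_char_0} poly)"
  by (intro poly_eqI) (simp add: coeff_map_poly coeff_mult)

lemma map_poly_of_int_eq_iff: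
  "map_poly of_int p = (map_poly of_int q :: 'a :: ring_char_0 poly) \<longleftrightarrow> p = q"
  by (auto simp: poly_eq_iff coeff_map_poly)

lemma poly_map_poly_of_int:
  "poly (map_poly of_int p) (of_int x :: 'a :: comm_ring_1) = of_int (poly p x)"
  by (induction p) (simp_all add: map_poly_pCons)

lemma degree_map_poly_of_int [simp]:
  "degree (map_poly of_int p :: 'a :: ring_char_0 poly) = degree p"
  by (rule degree_map_poly) simp

lemma rat_poly_clear_denominators:
  fixes q :: "rat poly"
  obtains d :: int and g :: "int poly" where "d > 0" "smult (of_int d) q = map_poly of_int g"
proof -
  have "\<exists>d g. d > 0 \<and> smult (of_int d) q = map_poly of_int g"
  proof (induction q)
    case 0
    show ?case by (intro exI[of _ 1] exI[of _ 0]) simp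
  next
    case (pCons c q)
    then obtain d g where dg: "d > 0" "smult (of_int d) q = map_poly of_int g" by blast
    obtain a b :: int where ab: "b > 0" "c = of_int a / of_int b"
      by (metis quotient_of_denom_pos quotient_of_div surj_pair)
    have "smult (of_int (b * d)) (pCons c q) = pCons (of_int (a * d)) (smult (of_int b) (smult (of_int d) q))"
      using ab by simp
    also have "\<dots> = map_poly of_int (pCons (a * d) (smult b g))"
      by (simp add: dg(2) map_poly_pCons map_poly_smult)
    finally show ?case
      using ab(1) dg(1) by (intro exI[of _ "b * d"] exI) auto
  qed
  with that show ?thesis by blast
qed

text \<open>Gauss's lemma: after clearing denominators, a positive multiple of \<open>f\<close> is a
  product of integer polynomials. Primitive parts are multiplicative and blind to positive scalars,
  so for nonzero \<open>f\<close> it remains to put \<open>content f\<close> back into one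
  factor.\<close>

lemma int_poly_factors_of_rat_factors:
  fixes f :: "int poly" and u v :: "rat poly"
  assumes "map_poly of_int f = u * v"
  obtains g h where "f = g * h" "degree g = degree u" "degree h = degree v"
proof -
  obtain a g where ag: "a > 0" "smult (of_int a) u = map_poly of_int g"
    by (rule rat_poly_clear_denominators)
  obtain b h where bh: "b > 0" "smult (of_int b) v = map_poly of_int h"
    by (rule rat_poly_clear_denominators)
  have deg: "degree g = degree u" "degree h = degree v"
    using arg_cong[OF ag(2), of degree] arg_cong[OF bh(2), of degree] ag(1) bh(1) by simp_all
  have "map_poly of_int (smult (a * b) f) = smult (of_int a) u * smult (of_int b) v"
    using assms by (simp add: map_poly_smult mult.commute)
  also have "\<dots> = map_poly of_int (g * h)"
    by (simp add: ag bh map_poly_of_int_mult)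
  finally have eq: "smult (a * b) f = g * h"
    by (simp only: map_poly_of_int_eq_iff)
  have "primitive_part f = primitive_part g * primitive_part h"
    using arg_cong[OF eq, of primitive_part] ag(1) bh(1)
    by (simp add: primitive_part_mult primitive_part_smult unit_factor_int_def)
  then have f: "f = smult (content f) (primitive_part g) * primitive_part h"
    by (metis content_times_primitive_part mult_smult_left)
  show ?thesis
  \<comment> \<open>If \<open>f = 0\<close>, then \<open>content f\<close> vanishes and the first
    factor in \<open>f\<close> could lose its degree; there \<open>g * h\<close>, which is itself
    zero, serves instead.\<close>
  proof (cases "f = 0")
    case True
    then have "f = g * h" using eq by simp
    then show ?thesis using deg by (rule that)
  next
    case False
    with deg show ?thesis by (intro that[OF f]) simp_all
  qed
qed

text \<open>Over the complex numbers \<open>q\<close> splits into its leading coefficient and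
  \<open>degree q\<close> linear factors, each of modulus at least \<open>r\<close> at
  \<open>x\<close>.\<close>

lemma cmod_poly_ge_power_degree:
  fixes q :: "complex poly"
  assumes "\<And>z. poly q z = 0 \<Longrightarrow> cmod (x - z) \<ge> r" "r \<ge> 0"
  shows "cmod (poly q x) \<ge> cmod (lead_coeff q) * r ^ degree q"
proof (cases "q = 0")
  case False
  obtain root where root: "smult (lead_coeff q) (\<Prod>i<degree q. [:-root i, 1:]) = q"
    by (rule complex_poly_decompose')
  have val: "poly q y = lead_coeff q * (\<Prod>i<degree q. y - root i)" for y
    by (subst root[symmetric]) (simp add: poly_prod)
  have "poly q (root i) = 0" if "i < degree q" for i
    using that by (auto simp: val)
  then have "(\<Prod>i<degree q. r) \<le> (\<Prod>i<degree q. cmod (x - root i))"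
    using assms by (intro prod_mono) auto
  then show ?thesis
    by (simp add: val norm_mult prod_norm mult_left_mono)
qed simp

text \<open>The reverse triangle inequality keeps every complex root at distance at least
  \<open>\<bar>n\<bar> - \<rho>\<close> from \<open>n\<close>, and a nonzero integer leading
  coefficient has modulus at least 1.\<close>

lemma root_bound_poly_ge:
  fixes g :: "int poly"
  assumes "root_bound g \<rho>" "of_int \<bar>n\<bar> \<ge> \<rho>" "g \<noteq> 0"
  shows "of_int \<bar>poly g n\<bar> \<ge> (of_int \<bar>n\<bar> - \<rho>) ^ degree g"
proof -
  \<comment> \<open>The modulus is real-valued, so the estimate uses the real image of this rational
    number and is pulled back at the end.\<close>
  define r :: real where "r = of_rat (of_int \<bar>n\<bar> - \<rho>)"
  have r: "r = \<bar>of_int n\<bar> - of_rat \<rho>"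
    by (simp add: r_def of_rat_diff flip: of_int_abs)
  have r_nonneg: "r \<ge> 0"
    using assms(2) by (simp add: r_def)
  let ?q = "map_poly of_int g :: complex poly"
  have "cmod (of_int n - z) \<ge> r" if "poly ?q z = 0" for z
  proof -
    have "cmod z \<le> of_rat \<rho>" using assms(1) that by (auto simp: root_bound_def)
    then show ?thesis
      using norm_triangle_ineq2[of "of_int n :: complex" z] r by simp
  qed
  from cmod_poly_ge_power_degree[of ?q, OF this r_nonneg]
  have "cmod (lead_coeff ?q) * r ^ degree g \<le> of_int \<bar>poly g n\<bar>"
    by (simp add: poly_map_poly_of_int)
  moreover have "1 * r ^ degree g \<le> cmod (lead_coeff ?q) * r ^ degree g"
  proof (rule mult_right_mono)
    have "\<bar>lead_coeff g\<bar> \<ge> 1" using assms(3) by (simp add: int_one_le_iff_zero_less)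
    then have "real_of_int \<bar>lead_coeff g\<bar> \<ge> 1" by linarith
    then show "1 \<le> cmod (lead_coeff ?q)" by (simp add: coeff_map_poly)
  qed (use r_nonneg in simp)
  ultimately have "of_rat ((of_int \<bar>n\<bar> - \<rho>) ^ degree g) \<le> (of_rat (of_int \<bar>poly g n\<bar>) :: real)"
    by (simp add: r_def of_rat_power flip: of_int_abs)
  then show ?thesis
    by (simp only: of_rat_less_eq)
qed

lemma root_bound_factor:
  assumes "root_bound (g * h) \<rho>"
  shows "root_bound g \<rho>"
  using assms by (auto simp: root_bound_def map_poly_of_int_mult)

text \<open>If \<open>p\<close> divided \<open>poly h n\<close>, cancelling it would leave
  \<open>poly g n\<close> as a divisor of \<open>s\<close>, too small for the lower bound that the
  roots of \<open>g\<close> impose. The asymmetric form allows use with the two factors in either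
  order.\<close>

lemma not_prime_dvd_cofactor_value:
  fixes g h :: "int poly"
  assumes "root_bound (g * h) \<rho>" "of_int \<bar>n\<bar> > 1 + \<rho>" "\<Delta> \<le> degree g"
    and "\<bar>poly (g * h) n\<bar> = s * p" "s > 0" "of_int s < (of_int \<bar>n\<bar> - \<rho>) ^ \<Delta>" "prime p"
  shows "\<not> p dvd poly h n"
proof
  assume "p dvd poly h n"
  then obtain k where k: "poly h n = p * k" by (elim dvdE)
  have p: "p > 0" using assms(7) by (rule prime_gt_0_int)
  have "p * (\<bar>poly g n\<bar> * \<bar>k\<bar>) = p * s"
    using assms(4) k p by (simp add: abs_mult mult_ac)
  then have s: "\<bar>poly g n\<bar> * \<bar>k\<bar> = s" using p by simp
  then have "\<bar>poly g n\<bar> \<le> s"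
    using assms(5) by (intro zdvd_imp_le) (auto intro: dvdI)
  have "g \<noteq> 0" using s assms(5) by auto
  \<comment> \<open>Raising the exponent requires a base of at least 1, which
    \<open>\<bar>n\<bar> > 1 + \<rho>\<close> supplies.\<close>
  have "(of_int \<bar>n\<bar> - \<rho>) ^ \<Delta> \<le> (of_int \<bar>n\<bar> - \<rho>) ^ degree g"
    using assms(2,3) by (intro power_increasing) auto
  also have "\<dots> \<le> of_int \<bar>poly g n\<bar>"
    using assms(2) \<open>g \<noteq> 0\<close> by (intro root_bound_poly_ge root_bound_factor[OF assms(1)]) auto
  also have "\<dots> \<le> of_int s"
    using \<open>\<bar>poly g n\<bar> \<le> s\<close> by (simp only: of_int_le_iff)
  finally show False using assms(6) by simp
qed

text \<open>Irreducibility over the integers is claimed only for content 1: \<open>2 * x\<close>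
  with \<open>\<rho> = 0\<close>, \<open>\<Delta> = 1\<close>, \<open>n = 3\<close>,
  \<open>s = 2\<close>, \<open>p = 3\<close> meets the hypotheses, yet it has the non-unit factor 2
  there.\<close>

theorem proposition2p2:
  fixes f :: "int poly" and \<rho> :: rat and \<Delta> :: nat and n s p :: int
  assumes "degree f > 0"
    and "root_bound f \<rho>"
    and "factor_degree_lower_bound f \<Delta>"
    and "of_int \<bar>n\<bar> > 1 + \<rho>"
    and "\<bar>poly f n\<bar> = s * p"
    and "s > 0"
    and "of_int s < (of_int \<bar>n\<bar> - \<rho>) ^ \<Delta>"
    and "prime p"
  shows "irreducible (map_poly of_int f :: rat poly) \<and> (content f = 1 \<longrightarrow> irreducible f)"
proof -
  have const: "degree g = 0 \<or> degree h = 0" if fgh: "f = g * h" for g h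
  proof (rule ccontr)
    assume "\<not> ?thesis"
    then have deg: "\<Delta> \<le> degree g" "\<Delta> \<le> degree h"
      using assms(3) fgh by (auto simp: factor_degree_lower_bound_def)
    have hg: "f = h * g" using fgh by (simp add: mult.commute)
    have "\<not> p dvd poly h n"
      using not_prime_dvd_cofactor_value[of g h] deg(1) assms unfolding fgh by blast
    moreover have "\<not> p dvd poly g n"
      using not_prime_dvd_cofactor_value[of h g] deg(2) assms unfolding hg by blast
    moreover have "p dvd \<bar>poly f n\<bar>" unfolding assms(5) by simp
    then have "p dvd poly g n * poly h n" by (simp add: fgh)
    ultimately show False
      using assms(8) by (simp add: prime_dvd_mult_iff)
  qed
  have "irreducible (map_poly of_int f :: rat poly)"
  proof (rule irreducibleI)
    show nz: "map_poly of_int f \<noteq> (0 :: rat poly)"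
      using assms(1) by (metis degree_0 degree_map_poly_of_int less_irrefl)
    then show "\<not> map_poly of_int f dvd (1 :: rat poly)"
      using assms(1) by (simp add: is_unit_iff_degree)
    fix u v :: "rat poly"
    assume uv: "map_poly of_int f = u * v"
    then have "degree u = 0 \<or> degree v = 0"
      by (metis const int_poly_factors_of_rat_factors)
    moreover have "u \<noteq> 0" "v \<noteq> 0" using nz uv by auto
    ultimately show "u dvd 1 \<or> v dvd 1" by (simp add: is_unit_iff_degree)
  qed
  moreover have "irreducible f" if cont: "content f = 1"
  proof (rule irreducibleI)
    \<comment> \<open>A constant dividing \<open>f\<close> divides every coefficient, hence the
      content, which is 1.\<close>
    have unit: "g dvd 1" if g: "g dvd f" "degree g = 0" for g
    proof -
      obtain c where c: "g = [:c:]" using g(2) by (rule degree_eq_zeroE)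
      then have "c dvd 1" using g(1) cont const_poly_dvd_iff_dvd_content[of c f] by simp
      then show ?thesis by (simp add: c is_unit_const_poly_iff)
    qed
    show "f \<noteq> 0" using assms(1) by auto
    show "\<not> f dvd 1" using assms(1) by (auto simp: is_unit_poly_iff)
    fix g h assume "f = g * h"
    then show "g dvd 1 \<or> h dvd 1" using const[of g h] unit by auto
  qed
  ultimately show ?thesis by blast
qed

end
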